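(* Let $Z_1,Z_2,\dots$ be i.i.d. copies of $Z\sim P$ and let $m_\xi:\mathcal Z\to\mathbb R$, $\xi\in\Xi$, be known measurable functions, with $M(\xi)=Pm_\xi=\mathrm E[m_\xi(Z)]$ and $M_n(\xi)=\frac1n\sum_{i=1}^nm_\xi(Z_i)$. Assume: (a) $\Xi$ is a convex open subset of a Euclidean space and $m_\xi(z)$ is a strictly concave function of $\xi\in\Xi$; (b) $M(\xi)$ is well defined for every $\xi\in\Xi$ and has a unique maximizer $\xi_0$, that is, $M(\xi_0)>M(\xi)$ for every $\xi\ne\xi_0$; (c) for every compact set $\mathcal K\subset\Xi$, $\mathrm E\left[\sup_{\xi\in\mathcal K}|m_\xi(Z)|\right]<\infty$; (d) there exist an open set $\Theta\subset\mathbb R^q$ and a map $g:\Theta\to\Xi$ such that $\xi_0\in g(\Theta)=\Xi^{\mathrm{res}}$. Then there exists a strong M-estimator for $M_n$ over $\Xi^{\mathrm{res}}$. Moreover, any strong M-estimator for $M_n$ over $\Xi^{\mathrm{res}}$ converges to $\xi_0$ in probability as $n\to\infty$.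
   Context: A strong M-estimator for the criterion function $M_n$ over $\Xi^{\mathrm{res}}$ is an estimator $\widehat\xi_n^{\mathrm{res}}=\widehat\xi_n^{\mathrm{res}}(Z_1,\dots,Z_n)\in\Xi^{\mathrm{res}}$ satisfying $M_n(\widehat\xi_n^{\mathrm{res}})\ge\sup_{\xi\in\Xi^{\mathrm{res}}}M_n(\xi)-A_n$ with $A_n=o_p(n^{-1})$. The map $g$ need not be injective, and $\Xi^{\mathrm{res}}$ need be neither convex nor closed.
   Formalization: The remainder A_n is allowed to take the value +∞ (on events of probability tending to 0), since the supremum of M_n over Ξ^res can be infinite with positive probability for every n, in which case no real-valued A_n could satisfy the defining inequality. *)

theory Defs
  imports "HOL-Probability.Probability"
begin

definition strictly_concave_on :: "'a::real_vector set \<Rightarrow> ('a \<Rightarrow> real) \<Rightarrow> bool" where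
  "strictly_concave_on S f \<longleftrightarrow>
     convex S \<and>
     (\<forall>x\<in>S. \<forall>y\<in>S. \<forall>t::real. x \<noteq> y \<longrightarrow> 0 < t \<longrightarrow> t < 1 \<longrightarrow>
        (1 - t) * f x + t * f y < f ((1 - t) *\<^sub>R x + t *\<^sub>R y))"

definition iid_copies :: "'w measure \<Rightarrow> 'z measure \<Rightarrow> (nat \<Rightarrow> 'w \<Rightarrow> 'z) \<Rightarrow> bool" where
  "iid_copies W P Z \<longleftrightarrow>
     prob_space.indep_vars W (\<lambda>_. P) Z {1..} \<and> (\<forall>i\<ge>1. distr W P (Z i) = P)"

definition population_criterion :: "'z measure \<Rightarrow> ('a \<Rightarrow> 'z \<Rightarrow> real) \<Rightarrow> 'a \<Rightarrow> real" where
  "population_criterion P m \<xi> = (\<integral>z. m \<xi> z \<partial>P)"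

definition empirical_criterion :: "('a \<Rightarrow> 'z \<Rightarrow> real) \<Rightarrow> nat \<Rightarrow> (nat \<Rightarrow> 'z) \<Rightarrow> 'a \<Rightarrow> real" where
  "empirical_criterion m n z \<xi> = (\<Sum>i=1..n. m \<xi> (z i)) / real n"

definition converges_in_probability ::
    "'w measure \<Rightarrow> (nat \<Rightarrow> 'w \<Rightarrow> 'a::metric_space) \<Rightarrow> 'a \<Rightarrow> bool" where
  "converges_in_probability W X x \<longleftrightarrow>
     (\<forall>\<epsilon>>0. (\<lambda>n. measure W {\<omega> \<in> space W. dist (X n \<omega>) x > \<epsilon>}) \<longlonglongrightarrow> 0)"

(* A_n = o_p(r_n) for extended real random variables and rates r_n > 0: A_n may be infinite,
   but only on events whose probability vanishes. *)
definition small_o_p :: "'w measure \<Rightarrow> (nat \<Rightarrow> 'w \<Rightarrow> ereal) \<Rightarrow> (nat \<Rightarrow> real) \<Rightarrow> bool" where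
  "small_o_p W A r \<longleftrightarrow>
     (\<forall>\<epsilon>>0. (\<lambda>n. measure W {\<omega> \<in> space W. \<bar>A n \<omega>\<bar> > ereal (\<epsilon> * r n)}) \<longlonglongrightarrow> 0)"

(* An estimator with values in R: for each n, a measurable function of (z_1, ..., z_n). *)
definition estimator ::
    "'z measure \<Rightarrow> 'a::topological_space set \<Rightarrow> (nat \<Rightarrow> (nat \<Rightarrow> 'z) \<Rightarrow> 'a) \<Rightarrow> bool" where
  "estimator P R est \<longleftrightarrow>
     (\<forall>n\<ge>1. est n \<in> borel_measurable (Pi\<^sub>M {1..n} (\<lambda>_. P)) \<and>
            est n \<in> space (Pi\<^sub>M {1..n} (\<lambda>_. P)) \<rightarrow> R)"

definition estimate ::
    "(nat \<Rightarrow> 'w \<Rightarrow> 'z) \<Rightarrow> (nat \<Rightarrow> (nat \<Rightarrow> 'z) \<Rightarrow> 'a) \<Rightarrow> nat \<Rightarrow> 'w \<Rightarrow> 'a" where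
  "estimate Z est n \<omega> = est n (\<lambda>i\<in>{1..n}. Z i \<omega>)"

(* The supremum of M_n over R may be infinite with positive probability for every n, so the
   inequality  M_n(est) >= sup M_n - A_n  is read in the extended reals.  A_n is moved to the left
   because M_n(est) is finite, whereas  sup M_n - A_n  could be infinity - infinity.
   A_n is automatically nonnegative, M_n(est) being at most the supremum. *)
definition strong_M_estimator ::
    "'w measure \<Rightarrow> 'z measure \<Rightarrow> (nat \<Rightarrow> 'w \<Rightarrow> 'z) \<Rightarrow> ('a::topological_space \<Rightarrow> 'z \<Rightarrow> real) \<Rightarrow> 'a set
      \<Rightarrow> (nat \<Rightarrow> (nat \<Rightarrow> 'z) \<Rightarrow> 'a) \<Rightarrow> bool" where
  "strong_M_estimator W P Z m R est \<longleftrightarrow>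
     estimator P R est \<and>
     (\<exists>A :: nat \<Rightarrow> 'w \<Rightarrow> ereal.
        (\<forall>n\<ge>1. A n \<in> borel_measurable W) \<and>
        small_o_p W A (\<lambda>n. 1 / real n) \<and>
        (\<forall>n\<ge>1. \<forall>\<omega>\<in>space W.
           ereal (empirical_criterion m n (\<lambda>i. Z i \<omega>) (estimate Z est n \<omega>)) + A n \<omega>
             \<ge> (SUP \<xi>\<in>R. ereal (empirical_criterion m n (\<lambda>i. Z i \<omega>) \<xi>))))"

end

theory Submission
  imports Defs
begin

text \<open>
  By concavity, uniform control of the empirical criterion is only needed on a small sphere around
  \<open>\<xi>\<^sub>0\<close>. Every point \<open>x\<close> of the sphere satisfies \<open>M x < M \<xi>\<^sub>0\<close>. Since concave functions on an open set are
  continuous, dominated convergence yields a ball around \<open>x\<close> on which the criterion functions have an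
  integrable majorant whose expectation is still below \<open>M \<xi>\<^sub>0\<close> (\<open>local_majorant\<close>). Finitely many such balls
  cover the sphere, and the weak law of large numbers (\<open>weak_law_upper\<close>), applied to the finitely many
  majorants, shows that with probability tending to one the empirical criterion on the sphere is below
  its value at \<open>\<xi>\<^sub>0\<close> by some fixed \<open>\<delta> > 0\<close>. Concavity carries this gap to the whole exterior of the
  ball (\<open>criterion_separation\<close>).

  Both claims follow. An estimate that lies outside the ball misses the supremum by at least \<open>\<delta>\<close>, which is
  improbable for a strong M-estimator (\<open>strong_M_estimator_consistent\<close>). On the good event the empirical
  criterion is moreover bounded above, by its maximum over the compact ball, so that a measurable near
  maximiser over a countable dense subset of the restricted parameter set is a strong M-estimator
  (\<open>strong_M_estimator_exists\<close>).
\<close>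

section \<open>A weak law of large numbers\<close>

lemma iid_copies_measurable:
  assumes "prob_space W" "iid_copies W P Z" "1 \<le> i"
  shows "Z i \<in> measurable W P"
  using assms by (auto simp: iid_copies_def prob_space.indep_vars_def)

lemma iid_copies_distr:
  assumes "iid_copies W P Z" "1 \<le> i"
  shows "distr W P (Z i) = P"
  using assms by (auto simp: iid_copies_def)

lemma iid_copies_integral:
  fixes h :: "'z \<Rightarrow> real"
  assumes "prob_space W" "iid_copies W P Z" "1 \<le> i" "h \<in> borel_measurable P"
  shows "(\<integral>\<omega>. h (Z i \<omega>) \<partial>W) = (\<integral>z. h z \<partial>P)"
proof -
  have "(\<integral>z. h z \<partial>distr W P (Z i)) = (\<integral>\<omega>. h (Z i \<omega>) \<partial>W)"
    using iid_copies_measurable[OF assms(1-3)] assms(4) by (rule integral_distr)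
  then show ?thesis
    by (simp add: iid_copies_distr[OF assms(2,3)])
qed

lemma iid_copies_integrable:
  fixes h :: "'z \<Rightarrow> real"
  assumes "prob_space W" "iid_copies W P Z" "1 \<le> i" "integrable P h"
  shows "integrable W (\<lambda>\<omega>. h (Z i \<omega>))"
  using iid_copies_measurable[OF assms(1-3)] assms(4) iid_copies_distr[OF assms(2,3)]
  by (metis integrable_distr)

lemma truncation_tendsto_L1:
  fixes h :: "'z \<Rightarrow> real"
  assumes [measurable]: "integrable P h"
  shows "(\<lambda>K. \<integral>z. \<bar>h z - (if \<bar>h z\<bar> \<le> real K then h z else 0)\<bar> \<partial>P) \<longlonglongrightarrow> 0"
proof -
  have "(\<lambda>K. \<integral>z. \<bar>h z - (if \<bar>h z\<bar> \<le> real K then h z else 0)\<bar> \<partial>P) \<longlonglongrightarrow> (\<integral>z. 0 \<partial>P)"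
  proof (rule integral_dominated_convergence[where w = "\<lambda>z. \<bar>h z\<bar>"])
    show "AE z in P. (\<lambda>K. \<bar>h z - (if \<bar>h z\<bar> \<le> real K then h z else 0)\<bar>) \<longlonglongrightarrow> 0"
    proof (rule AE_I2, rule tendsto_eventually)
      fix z
      show "\<forall>\<^sub>F K in sequentially. \<bar>h z - (if \<bar>h z\<bar> \<le> real K then h z else 0)\<bar> = 0"
        using eventually_ge_at_top[of "nat \<lceil>\<bar>h z\<bar>\<rceil>"]
        by eventually_elim (auto simp: nat_le_iff ceiling_le_iff)
    qed
  qed (use assms in auto)
  then show ?thesis by simp
qed

text \<open>Hoeffding's inequality makes the probability decay exponentially in \<open>n\<close>.\<close>

lemma weak_law_bounded:
  fixes h :: "'z \<Rightarrow> real"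
  assumes W: "prob_space W" and iid: "iid_copies W P Z" and [measurable]: "h \<in> borel_measurable P"
    and bounded: "\<And>z. z \<in> space P \<Longrightarrow> \<bar>h z\<bar> \<le> K"
    and gap: "(\<integral>z. h z \<partial>P) < c"
  shows "(\<lambda>n. measure W {\<omega> \<in> space W. c \<le> (\<Sum>i=1..n. h (Z i \<omega>)) / real n}) \<longlonglongrightarrow> 0"
proof (rule tendsto_sandwich[OF _ _ tendsto_const])
  interpret W: prob_space W by fact
  define e where "e = c - (\<integral>z. h z \<partial>P)"
  \<comment> \<open>positive, as the interval in Hoeffding's inequality must not degenerate to a point\<close>
  define B where "B = max K 1"
  have e: "e > 0" and B: "B > 0" using gap by (auto simp: e_def B_def)
  have Z [measurable]: "Z i \<in> measurable W P" if "1 \<le> i" for i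
    using iid_copies_measurable[OF W iid that] .
  have 1: "measure W {\<omega> \<in> space W. c \<le> (\<Sum>i=1..n. h (Z i \<omega>)) / real n}
      \<le> exp (- 2 * real n * e\<^sup>2 / (B - - B)\<^sup>2)" if n: "1 \<le> n" for n
  proof -
    have "W.indep_vars (\<lambda>_. P) Z {1..n}"
      using iid W.indep_vars_subset[of "\<lambda>_. P" Z "{1..}" "{1..n}"]
      by (auto simp: iid_copies_def)
    then have indep: "W.indep_vars (\<lambda>_. borel) (\<lambda>i \<omega>. h (Z i \<omega>)) {1..n}"
      by (rule W.indep_vars_compose2) simp
    have distr: "distr W borel (\<lambda>\<omega>. h (Z i \<omega>)) = distr P borel h" if "1 \<le> i" for i
    proof -
      have "distr W borel (\<lambda>\<omega>. h (Z i \<omega>)) = distr (distr W P (Z i)) borel h"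
        using that by (subst distr_distr) (auto simp: comp_def)
      then show ?thesis by (simp add: iid_copies_distr[OF iid that])
    qed
    interpret Hoeffding_ineq_iid W "{1..n}" "\<lambda>i \<omega>. h (Z i \<omega>)" "\<lambda>\<omega>. h (Z 1 \<omega>)" "- B" B
        "W.expectation (\<lambda>\<omega>. h (Z 1 \<omega>))"
    proof unfold_locales
      show "AE \<omega> in W. h (Z 1 \<omega>) \<in> {- B..B}"
      proof (rule AE_I2)
        fix \<omega> assume "\<omega> \<in> space W"
        then have "Z 1 \<omega> \<in> space P" using measurable_space[OF Z[of 1]] by simp
        from bounded[OF this] show "h (Z 1 \<omega>) \<in> {- B..B}" by (auto simp: B_def)
      qed
    qed (use indep distr in auto)
    have c: "W.expectation (\<lambda>\<omega>. h (Z 1 \<omega>)) + e = c"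
      unfolding e_def by (subst iid_copies_integral[OF W iid]) auto
    have "measure W {\<omega> \<in> space W. W.expectation (\<lambda>\<omega>. h (Z 1 \<omega>)) + e
          \<le> (\<Sum>i=1..n. h (Z i \<omega>)) / real (card {1..n})}
        \<le> exp (- 2 * real (card {1..n}) * e\<^sup>2 / (B - - B)\<^sup>2)"
      by (rule Hoeffding_ineq_ge') (use e B n in auto)
    then show ?thesis
      unfolding c by (simp only: card_atLeastAtMost diff_Suc_1)
  qed
  show "\<forall>\<^sub>F n in sequentially. measure W {\<omega> \<in> space W. c \<le> (\<Sum>i=1..n. h (Z i \<omega>)) / real n}
      \<le> exp (- 2 * real n * e\<^sup>2 / (B - - B)\<^sup>2)"
    using eventually_ge_at_top[of 1] by eventually_elim (rule 1)
  have "(\<lambda>n. exp (- (2 * e\<^sup>2 / (B - - B)\<^sup>2)) ^ n) \<longlonglongrightarrow> 0"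
    using e B by (intro LIMSEQ_realpow_zero) auto
  moreover have "exp (- (2 * e\<^sup>2 / (B - - B)\<^sup>2)) ^ n = exp (- 2 * real n * e\<^sup>2 / (B - - B)\<^sup>2)" for n
    by (subst exp_of_nat_mult[symmetric], rule arg_cong[where f = exp]) simp
  ultimately show "(\<lambda>n. exp (- 2 * real n * e\<^sup>2 / (B - - B)\<^sup>2)) \<longlonglongrightarrow> 0"
    by simp
qed auto

text \<open>Integrability suffices for the weak law. The function \<open>h\<close> is split into its truncation \<open>t\<close> at a level
  \<open>K\<close> and the remainder \<open>r = \<bar>h - t\<bar>\<close>: the mean of \<open>t\<close> obeys the bounded law, and that of \<open>r\<close> is
  controlled, uniformly in \<open>n\<close>, by Markov's inequality once \<open>K\<close> is so large that \<open>r\<close> has a small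
  expectation. Only the upper tail is needed below.\<close>

lemma weak_law_upper:
  fixes h :: "'z \<Rightarrow> real"
  assumes W: "prob_space W" and iid: "iid_copies W P Z" and int: "integrable P h"
    and gap: "(\<integral>z. h z \<partial>P) < c"
  shows "(\<lambda>n. measure W {\<omega> \<in> space W. c \<le> (\<Sum>i=1..n. h (Z i \<omega>)) / real n}) \<longlonglongrightarrow> 0"
proof (rule LIMSEQ_I)
  fix \<rho> :: real assume \<rho>: "\<rho> > 0"
  interpret W: prob_space W by fact
  define e where "e = c - (\<integral>z. h z \<partial>P)"
  have e: "e > 0" using gap by (simp add: e_def)
  have [measurable]: "h \<in> borel_measurable P" using int by auto
  have Z [measurable]: "Z i \<in> measurable W P" if "1 \<le> i" for i
    using iid_copies_measurable[OF W iid that] .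
  have "min (e / 4) (\<rho> * e / 4) > 0" using e \<rho> by simp
  from order_tendstoD(2)[OF truncation_tendsto_L1[OF int] this] obtain K :: nat where
    K: "(\<integral>z. \<bar>h z - (if \<bar>h z\<bar> \<le> real K then h z else 0)\<bar> \<partial>P) < min (e / 4) (\<rho> * e / 4)"
    by (auto simp: eventually_sequentially)
  define t where "t = (\<lambda>z. if \<bar>h z\<bar> \<le> real K then h z else 0)"
  define r where "r = (\<lambda>z. \<bar>h z - t z\<bar>)"
  have [measurable]: "t \<in> borel_measurable P" "r \<in> borel_measurable P" by (auto simp: t_def r_def)
  have int_t: "integrable P t"
    by (rule Bochner_Integration.integrable_bound[OF int]) (auto simp: t_def)
  have int_r: "integrable P r" using int int_t by (auto simp: r_def)
  have r: "(\<integral>z. r z \<partial>P) < e / 4" "(\<integral>z. r z \<partial>P) < \<rho> * e / 4"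
    using K by (auto simp: r_def t_def)
  have "(\<integral>z. t z \<partial>P) \<le> (\<integral>z. h z + r z \<partial>P)"
    by (rule integral_mono) (use int int_t int_r in \<open>auto simp: r_def\<close>)
  then have t: "(\<integral>z. t z \<partial>P) < c - e / 2"
    using r(1) int int_r e unfolding e_def by simp argo
  have "(\<lambda>n. measure W {\<omega> \<in> space W. c - e / 2 \<le> (\<Sum>i=1..n. t (Z i \<omega>)) / real n}) \<longlonglongrightarrow> 0"
    by (rule weak_law_bounded[OF W iid _ _ t, of K]) (auto simp: t_def)
  from order_tendstoD(2)[OF this, of "\<rho> / 2"] \<rho> obtain N where
    N: "\<And>n. n \<ge> N \<Longrightarrow>
      measure W {\<omega> \<in> space W. c - e / 2 \<le> (\<Sum>i=1..n. t (Z i \<omega>)) / real n} < \<rho> / 2"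
    by (auto simp: eventually_sequentially)
  have R: "measure W {\<omega> \<in> space W. e / 2 \<le> (\<Sum>i=1..n. r (Z i \<omega>)) / real n} < \<rho> / 2"
    if n: "1 \<le> n" for n
  proof -
    have int': "integrable W (\<lambda>\<omega>. r (Z i \<omega>))" if "i \<in> {1..n}" for i
      using that iid_copies_integrable[OF W iid _ int_r] by auto
    have "measure W {\<omega> \<in> space W. e / 2 \<le> (\<Sum>i=1..n. r (Z i \<omega>)) / real n}
        \<le> (\<integral>\<omega>. (\<Sum>i=1..n. r (Z i \<omega>)) / real n \<partial>W) / (e / 2)"
    proof (rule integral_Markov_inequality_measure[where A = "space W"])
      show "integrable W (\<lambda>\<omega>. (\<Sum>i=1..n. r (Z i \<omega>)) / real n)"
        by (intro integrable_divide_zero Bochner_Integration.integrable_sum int' impI)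
      show "AE \<omega> in W. 0 \<le> (\<Sum>i=1..n. r (Z i \<omega>)) / real n"
        by (intro AE_I2 divide_nonneg_nonneg sum_nonneg) (auto simp: r_def)
    qed (use e in auto)
    also have "(\<integral>\<omega>. (\<Sum>i=1..n. r (Z i \<omega>)) / real n \<partial>W) = (\<Sum>i=1..n. \<integral>\<omega>. r (Z i \<omega>) \<partial>W) / real n"
      using int' by (subst Bochner_Integration.integral_sum[symmetric]) auto
    also have "(\<Sum>i=1..n. \<integral>\<omega>. r (Z i \<omega>) \<partial>W) = (\<Sum>i=1..n. \<integral>z. r z \<partial>P)"
      by (intro sum.cong refl iid_copies_integral[OF W iid]) auto
    also have "(\<Sum>i=1..n. \<integral>z. r z \<partial>P) / real n / (e / 2) < \<rho> / 2"
      using r(2) e n by (simp add: field_simps)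
    finally show ?thesis .
  qed
  show "\<exists>no. \<forall>n\<ge>no. norm (measure W {\<omega> \<in> space W. c \<le> (\<Sum>i=1..n. h (Z i \<omega>)) / real n} - 0) < \<rho>"
  proof (intro exI allI impI)
    fix n assume n: "max N 1 \<le> n"
    let ?T = "{\<omega> \<in> space W. c - e / 2 \<le> (\<Sum>i=1..n. t (Z i \<omega>)) / real n}"
    let ?R = "{\<omega> \<in> space W. e / 2 \<le> (\<Sum>i=1..n. r (Z i \<omega>)) / real n}"
    have "{\<omega> \<in> space W. c \<le> (\<Sum>i=1..n. h (Z i \<omega>)) / real n} \<subseteq> ?T \<union> ?R"
    proof safe
      fix \<omega> assume 1: "c \<le> (\<Sum>i=1..n. h (Z i \<omega>)) / real n"
        and 2: "\<not> e / 2 \<le> (\<Sum>i=1..n. r (Z i \<omega>)) / real n"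
      have "(\<Sum>i=1..n. h (Z i \<omega>)) \<le> (\<Sum>i=1..n. t (Z i \<omega>) + r (Z i \<omega>))"
        by (rule sum_mono) (auto simp: r_def)
      then have "(\<Sum>i=1..n. h (Z i \<omega>)) / real n
          \<le> (\<Sum>i=1..n. t (Z i \<omega>)) / real n + (\<Sum>i=1..n. r (Z i \<omega>)) / real n"
        by (simp add: sum.distrib divide_right_mono flip: add_divide_distrib)
      then show "c - e / 2 \<le> (\<Sum>i=1..n. t (Z i \<omega>)) / real n"
        using 1 2 by linarith
    qed
    then have "measure W {\<omega> \<in> space W. c \<le> (\<Sum>i=1..n. h (Z i \<omega>)) / real n} \<le> measure W (?T \<union> ?R)"
      by (rule W.finite_measure_mono) measurable
    also have "\<dots> \<le> measure W ?T + measure W ?R"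
      by (rule measure_Un_le) measurable
    also have "\<dots> < \<rho>" using N[of n] R[of n] n by simp
    finally show "norm (measure W {\<omega> \<in> space W. c \<le> (\<Sum>i=1..n. h (Z i \<omega>)) / real n} - 0) < \<rho>"
      by simp
  qed
qed

section \<open>Concave functions\<close>

lemma strictly_concave_on_imp_concave_on:
  assumes "strictly_concave_on S f" shows "concave_on S f"
  unfolding concave_on_def
proof (rule convex_onI)
  fix t :: real and x y
  assume *: "0 < t" "t < 1" "x \<in> S" "y \<in> S"
  show "- f ((1 - t) *\<^sub>R x + t *\<^sub>R y) \<le> (1 - t) * - f x + t * - f y"
  proof (cases "x = y")
    case True
    then show ?thesis by (simp add: scaleR_left_diff_distrib left_diff_distrib)
  next
    case False
    with * assms have "(1 - t) * f x + t * f y < f ((1 - t) *\<^sub>R x + t *\<^sub>R y)"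
      unfolding strictly_concave_on_def by blast
    then show ?thesis by simp
  qed
qed (use assms in \<open>simp add: strictly_concave_on_def\<close>)

lemma concave_on_continuous:
  fixes S :: "'a::euclidean_space set"
  assumes "open S" "concave_on S f" shows "continuous_on S f"
  using continuous_on_minus[OF convex_on_continuous[OF assms(1) assms(2)[unfolded concave_on_def]]]
  by simp

lemma concave_on_empirical_criterion:
  assumes "convex S" and "\<And>i. i \<in> {1..n} \<Longrightarrow> concave_on S (\<lambda>\<xi>. m \<xi> (z i))"
  shows "concave_on S (empirical_criterion m n z)"
  unfolding concave_on_iff
proof (intro conjI ballI allI impI)
  fix x y and u v :: real
  assume xy: "x \<in> S" "y \<in> S" and uv: "0 \<le> u" "0 \<le> v" "u + v = 1"
  have "u * (\<Sum>i=1..n. m x (z i)) + v * (\<Sum>i=1..n. m y (z i))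
      = (\<Sum>i=1..n. u * m x (z i) + v * m y (z i))"
    by (simp add: sum.distrib sum_distrib_left)
  also have "\<dots> \<le> (\<Sum>i=1..n. m (u *\<^sub>R x + v *\<^sub>R y) (z i))"
    using assms(2) xy uv unfolding concave_on_iff by (intro sum_mono) auto
  finally show "u * empirical_criterion m n z x + v * empirical_criterion m n z y
      \<le> empirical_criterion m n z (u *\<^sub>R x + v *\<^sub>R y)"
    unfolding empirical_criterion_def
    by (simp add: divide_right_mono flip: add_divide_distrib)
qed fact

text \<open>A gap between the value at the centre and the values on a sphere persists everywhere outside the
  ball, because along each ray from the centre a concave function lies below its chord beyond the
  sphere.\<close>

lemma concave_on_le_outside_ball:
  fixes f :: "'a::real_normed_vector \<Rightarrow> real"
  assumes conc: "concave_on S f" and "x0 \<in> S" "x \<in> S" and e: "0 < \<epsilon>" "\<epsilon> \<le> dist x x0" and "0 \<le> \<delta>"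
    and sphere: "\<And>y. y \<in> sphere x0 \<epsilon> \<Longrightarrow> f y \<le> f x0 - \<delta>"
  shows "f x \<le> f x0 - \<delta>"
proof -
  define t where "t = \<epsilon> / dist x x0"
  have t: "0 < t" "t \<le> 1"
    using e order_less_le_trans[OF e] by (auto simp: t_def simp del: zero_less_dist_iff)
  have "(1 - t) *\<^sub>R x0 + t *\<^sub>R x = x0 + t *\<^sub>R (x - x0)" by (simp add: algebra_simps)
  moreover have "x0 + t *\<^sub>R (x - x0) \<in> sphere x0 \<epsilon>"
    using e by (auto simp: t_def dist_norm)
  moreover have "(1 - t) * f x0 + t * f x \<le> f ((1 - t) *\<^sub>R x0 + t *\<^sub>R x)"
    using conc assms(2,3) t unfolding concave_on_iff by auto
  ultimately have "(1 - t) * f x0 + t * f x \<le> f x0 - \<delta>"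
    using sphere by fastforce
  then have "\<delta> \<le> t * (f x0 - f x)" by (simp add: algebra_simps)
  moreover from this have "0 \<le> f x0 - f x"
    using t \<open>0 \<le> \<delta>\<close> by (meson dual_order.trans zero_le_mult_iff not_less)
  ultimately show ?thesis
    using t mult_right_mono[of t 1 "f x0 - f x"] by simp
qed

section \<open>Local majorants of the criterion\<close>

lemma continuous_on_le_closure:
  fixes f :: "'a::metric_space \<Rightarrow> real"
  assumes "continuous_on S f" "D \<subseteq> S" "x \<in> S" "x \<in> closure D" "\<And>y. y \<in> D \<Longrightarrow> f y \<le> c"
  shows "f x \<le> c"
proof -
  from \<open>x \<in> closure D\<close> obtain y where y: "\<And>n. y n \<in> D" "y \<longlonglongrightarrow> x"
    by (auto simp: closure_sequential)
  have "(\<lambda>n. f (y n)) \<longlonglongrightarrow> f x"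
    using y assms(2,3) by (intro continuous_on_tendsto_compose[OF assms(1)] always_eventually) auto
  then show ?thesis
    using y assms(5) by (intro LIMSEQ_le_const2) auto
qed

text \<open>The supremum over an uncountable set \<open>K\<close> may fail to be measurable, so the finiteness of its integral
  is transferred to the supremum over a countable subset \<open>D\<close>.\<close>

lemma integrable_cSUP_abs:
  fixes m :: "'a \<Rightarrow> 'z \<Rightarrow> real"
  assumes "countable D" "D \<noteq> {}" "D \<subseteq> K"
    and "\<And>x. x \<in> D \<Longrightarrow> m x \<in> borel_measurable P"
    and fin: "(\<integral>\<^sup>+z. (SUP x\<in>K. ennreal \<bar>m x z\<bar>) \<partial>P) < \<infinity>"
    and bdd: "\<And>z. z \<in> space P \<Longrightarrow> bdd_above ((\<lambda>x. \<bar>m x z\<bar>) ` D)"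
  shows "integrable P (\<lambda>z. SUP x\<in>D. \<bar>m x z\<bar>)"
proof (rule integrableI_bounded)
  show "(\<lambda>z. SUP x\<in>D. \<bar>m x z\<bar>) \<in> borel_measurable P"
    using assms by (intro borel_measurable_cSUP borel_measurable_abs) auto
  have "(\<integral>\<^sup>+z. ennreal (norm (SUP x\<in>D. \<bar>m x z\<bar>)) \<partial>P) \<le> (\<integral>\<^sup>+z. (SUP x\<in>K. ennreal \<bar>m x z\<bar>) \<partial>P)"
  proof (rule nn_integral_mono)
    fix z assume z: "z \<in> space P"
    obtain x0 where x0: "x0 \<in> D" using \<open>D \<noteq> {}\<close> by blast
    have nonneg: "0 \<le> (SUP x\<in>D. \<bar>m x z\<bar>)"
      using cSUP_upper[OF x0 bdd[OF z]] abs_ge_zero order_trans by blast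
    show "ennreal (norm (SUP x\<in>D. \<bar>m x z\<bar>)) \<le> (SUP x\<in>K. ennreal \<bar>m x z\<bar>)"
    proof (cases "SUP x\<in>K. ennreal \<bar>m x z\<bar>")
      case (real s)
      have "\<bar>m x z\<bar> \<le> s" if "x \<in> D" for x
      proof -
        have "ennreal \<bar>m x z\<bar> \<le> ennreal s"
          using that \<open>D \<subseteq> K\<close> unfolding real(2)[symmetric] by (intro SUP_upper) auto
        then show ?thesis using real(1) by simp
      qed
      then have "(SUP x\<in>D. \<bar>m x z\<bar>) \<le> s" using \<open>D \<noteq> {}\<close> by (intro cSUP_least) auto
      then show ?thesis using nonneg real by (simp add: ennreal_leI)
    next
      case top
      then show ?thesis by (simp only: top_greatest)
    qed
  qed
  then show "(\<integral>\<^sup>+z. ennreal (norm (SUP x\<in>D. \<bar>m x z\<bar>)) \<partial>P) < \<infinity>" using fin by (rule le_less_trans)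
qed

text \<open>Wald's argument: the supremum of \<open>m y z\<close> over a ball around \<open>x\<close> decreases to \<open>m x z\<close> as the radius
  shrinks, and by dominated convergence so do the expectations. The suprema are taken over a countable
  dense set \<open>D\<close>, which makes them measurable and, by continuity, does not change them.\<close>

lemma local_majorant:
  fixes m :: "'a::euclidean_space \<Rightarrow> 'z \<Rightarrow> real"
  assumes "open \<Xi>" and meas: "\<And>\<xi>. \<xi> \<in> \<Xi> \<Longrightarrow> m \<xi> \<in> borel_measurable P"
    and cont: "\<And>z. z \<in> space P \<Longrightarrow> continuous_on \<Xi> (\<lambda>\<xi>. m \<xi> z)"
    and dom: "\<And>K. compact K \<Longrightarrow> K \<subseteq> \<Xi> \<Longrightarrow> (\<integral>\<^sup>+z. (SUP \<xi>\<in>K. ennreal \<bar>m \<xi> z\<bar>) \<partial>P) < \<infinity>"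
    and x: "x \<in> \<Xi>" and gap: "(\<integral>z. m x z \<partial>P) < c"
  obtains r U where "0 < r" "integrable P U" "(\<integral>z. U z \<partial>P) < c"
    "\<And>z y. z \<in> space P \<Longrightarrow> y \<in> ball x r \<Longrightarrow> m y z \<le> U z"
proof -
  obtain r0 where r0: "r0 > 0" "cball x r0 \<subseteq> \<Xi>"
    using open_contains_cball \<open>open \<Xi>\<close> x by metis
  obtain D :: "'a set" where D: "countable D" "closure D = UNIV"
    using separable[of "UNIV :: 'a set"] by (metis top.extremum_uniqueI)
  define B where "B k = ball x (r0 / real (Suc k))" for k
  define U where "U k z = (SUP y\<in>D \<inter> B k. m y z)" for k z
  define H where "H z = (SUP y\<in>D \<inter> B 0. \<bar>m y z\<bar>)" for z
  have B_sub: "B k \<subseteq> B 0" for k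
    unfolding B_def using r0 by (intro subset_ball) (auto simp: field_simps)
  have B0: "B 0 \<subseteq> cball x r0" by (auto simp: B_def)
  have B_dense: "y \<in> closure (D \<inter> B k)" if "y \<in> B k" for y k
    using that open_Int_closure_subset[of "B k" D] D(2) by (auto simp: B_def Int_commute)
  have x_B: "x \<in> B k" for k using r0 by (simp add: B_def)
  have DB: "D \<inter> B k \<noteq> {}" for k
    using B_dense[OF x_B, of k] by auto
  have meas_B: "m y \<in> borel_measurable P" if "y \<in> B k" for y k
    using that B_sub B0 r0 by (intro meas) blast
  have bdd_abs: "bdd_above ((\<lambda>y. \<bar>m y z\<bar>) ` (D \<inter> B 0))" if "z \<in> space P" for z
  proof -
    have "compact ((\<lambda>y. \<bar>m y z\<bar>) ` cball x r0)"
      using continuous_on_subset[OF cont[OF that] r0(2)]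
      by (intro compact_continuous_image continuous_intros) auto
    then show ?thesis
      using B0 by (intro bdd_above_mono[OF bounded_imp_bdd_above[OF compact_imp_bounded]]) auto
  qed
  have abs_H: "\<bar>m y z\<bar> \<le> H z" if "z \<in> space P" "y \<in> D \<inter> B k" for z y k
    unfolding H_def using that B_sub by (intro cSUP_upper[OF _ bdd_abs]) auto
  have bdd: "bdd_above ((\<lambda>y. m y z) ` (D \<inter> B k))" if "z \<in> space P" for z k
    using abs_H[OF that, of _ k] by (intro bdd_aboveI2[of _ _ "H z"]) (meson abs_le_D1)
  have le_U: "m y z \<le> U k z" if z: "z \<in> space P" and y: "y \<in> B k" for z y k
  proof (rule continuous_on_le_closure[OF continuous_on_subset[OF cont[OF z] r0(2)]])
    show "m y' z \<le> U k z" if "y' \<in> D \<inter> B k" for y'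
      unfolding U_def using that by (intro cSUP_upper bdd z) auto
  qed (use y B_dense[OF y] B_sub B0 in blast)+
  have U_H: "\<bar>U k z\<bar> \<le> H z" if z: "z \<in> space P" for z k
  proof -
    obtain y where y: "y \<in> D \<inter> B k" using DB by blast
    have "U k z \<le> H z"
      unfolding U_def using abs_H[OF z, of _ k] DB by (intro cSUP_least) (auto dest: abs_le_D1)
    moreover have "- H z \<le> U k z"
      using le_U[OF z, of y k] abs_H[OF z y] y by auto
    ultimately show ?thesis by (simp add: abs_le_iff)
  qed
  have int_H: "integrable P H"
    unfolding H_def
    by (rule integrable_cSUP_abs[where K = "cball x r0"])
      (use D DB B0 meas_B bdd_abs dom[OF compact_cball r0(2)] in auto)
  have meas_U: "U k \<in> borel_measurable P" for k
    unfolding U_def[abs_def] using D meas_B bdd by (intro borel_measurable_cSUP) auto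
  have U_lim: "(\<lambda>k. U k z) \<longlonglongrightarrow> m x z" if z: "z \<in> space P" for z
  proof (rule LIMSEQ_I)
    fix e :: real assume e: "e > 0"
    have "continuous (at x) (\<lambda>\<xi>. m \<xi> z)"
      using cont[OF z] \<open>open \<Xi>\<close> x by (simp add: continuous_on_eq_continuous_at)
    then obtain d where d: "d > 0" "\<And>y. dist y x < d \<Longrightarrow> dist (m y z) (m x z) < e / 2"
      using e unfolding continuous_at_eps_delta by (metis half_gt_zero)
    obtain k0 :: nat where "r0 / d < real k0" using reals_Archimedean2 by blast
    then have "r0 < real k0 * d" using d(1) by (simp add: pos_divide_less_eq)
    then have k0: "r0 / real (Suc k0) < d" using d(1) by (simp add: pos_divide_less_eq algebra_simps)
    show "\<exists>no. \<forall>k\<ge>no. norm (U k z - m x z) < e"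
    proof (intro exI allI impI)
      fix k assume "k0 \<le> k"
      then have "r0 / real (Suc k) \<le> r0 / real (Suc k0)"
        using r0 by (intro divide_left_mono) auto
      then have 0: "dist y x < d" if "y \<in> B k" for y
        using that k0 by (auto simp: B_def dist_commute)
      have "m y z \<le> m x z + e / 2" if "y \<in> D \<inter> B k" for y
        using d(2)[OF 0[of y]] that abs_le_D1[of "m y z - m x z" "e / 2"]
        by (simp add: dist_real_def)
      then have "U k z \<le> m x z + e / 2"
        unfolding U_def using DB by (intro cSUP_least) auto
      then show "norm (U k z - m x z) < e"
        using le_U[OF z x_B[of k]] e by simp
    qed
  qed
  have "(\<lambda>k. \<integral>z. U k z \<partial>P) \<longlonglongrightarrow> (\<integral>z. m x z \<partial>P)"
    by (rule integral_dominated_convergence[where w = H])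
      (use meas_U meas[OF x] int_H U_lim U_H in auto)
  from order_tendstoD(2)[OF this gap] obtain k where k: "(\<integral>z. U k z \<partial>P) < c"
    by (auto simp: eventually_sequentially)
  show thesis
  proof (rule that[of "r0 / real (Suc k)" "U k"])
    show "integrable P (U k)"
      by (rule Bochner_Integration.integrable_bound[OF int_H meas_U])
        (auto intro!: AE_I2 order_trans[OF U_H abs_ge_self])
  qed (use r0 k le_U in \<open>auto simp: B_def\<close>)
qed

section \<open>Separation of the empirical criterion\<close>

lemma small_o_pD:
  assumes "small_o_p W A r" "0 < \<epsilon>"
  shows "(\<lambda>n. measure W {\<omega> \<in> space W. ereal (\<epsilon> * r n) < \<bar>A n \<omega>\<bar>}) \<longlonglongrightarrow> 0"
  using assms by (simp add: small_o_p_def)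

lemma empirical_criterion_cong:
  assumes "\<And>i. i \<in> {1..n} \<Longrightarrow> z i = z' i"
  shows "empirical_criterion m n z = empirical_criterion m n z'"
  using assms by (auto simp: empirical_criterion_def fun_eq_iff intro!: sum.cong)

text \<open>With probability tending to one, \<open>\<xi>\<^sub>0\<close> beats every point of \<open>\<Xi>\<close> at distance at least \<open>\<epsilon>\<close> by a
  fixed margin \<open>\<delta>\<close>. Finitely many of the balls of \<open>local_majorant\<close> cover the sphere of radius \<open>\<epsilon>\<close>; the
  exceptional event is that the weak law fails for one of the corresponding majorants.\<close>

lemma criterion_separation:
  fixes m :: "'a::euclidean_space \<Rightarrow> 'z \<Rightarrow> real"
  assumes W: "prob_space W" and iid: "iid_copies W P Z"
    and meas: "\<And>\<xi>. \<xi> \<in> \<Xi> \<Longrightarrow> m \<xi> \<in> borel_measurable P"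
    and "open \<Xi>" and conc: "\<And>z. z \<in> space P \<Longrightarrow> concave_on \<Xi> (\<lambda>\<xi>. m \<xi> z)"
    and int: "integrable P (m \<xi>\<^sub>0)"
    and max: "\<And>\<xi>. \<xi> \<in> \<Xi> \<Longrightarrow> \<xi> \<noteq> \<xi>\<^sub>0 \<Longrightarrow> population_criterion P m \<xi> < population_criterion P m \<xi>\<^sub>0"
    and dom: "\<And>K. compact K \<Longrightarrow> K \<subseteq> \<Xi> \<Longrightarrow> (\<integral>\<^sup>+z. (SUP \<xi>\<in>K. ennreal \<bar>m \<xi> z\<bar>) \<partial>P) < \<infinity>"
    and \<epsilon>: "0 < \<epsilon>" "cball \<xi>\<^sub>0 \<epsilon> \<subseteq> \<Xi>"
  obtains \<delta> Bad where "0 < \<delta>" "\<And>n. Bad n \<in> sets W" "(\<lambda>n. measure W (Bad n)) \<longlonglongrightarrow> 0"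
    "\<And>n \<omega> \<xi>. 1 \<le> n \<Longrightarrow> \<omega> \<in> space W \<Longrightarrow> \<omega> \<notin> Bad n \<Longrightarrow> \<xi> \<in> \<Xi> \<Longrightarrow> \<epsilon> \<le> dist \<xi> \<xi>\<^sub>0 \<Longrightarrow>
      empirical_criterion m n (\<lambda>i. Z i \<omega>) \<xi> \<le> empirical_criterion m n (\<lambda>i. Z i \<omega>) \<xi>\<^sub>0 - \<delta>"
proof -
  interpret W: prob_space W by fact
  have Z [measurable]: "Z i \<in> measurable W P" if "1 \<le> i" for i
    using iid_copies_measurable[OF W iid that] .
  have cont: "continuous_on \<Xi> (\<lambda>\<xi>. m \<xi> z)" if "z \<in> space P" for z
    using concave_on_continuous[OF \<open>open \<Xi>\<close> conc[OF that]] .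
  have \<xi>\<^sub>0: "\<xi>\<^sub>0 \<in> \<Xi>" using \<epsilon> by auto
  let ?S = "sphere \<xi>\<^sub>0 \<epsilon>"
  have "\<exists>r U. 0 < r \<and> integrable P U \<and> (\<integral>z. U z \<partial>P) < (\<integral>z. m \<xi>\<^sub>0 z \<partial>P) \<and>
      (\<forall>z\<in>space P. \<forall>y\<in>ball x r. m y z \<le> U z)" if "x \<in> ?S" for x
  proof -
    have x: "x \<in> \<Xi>" "x \<noteq> \<xi>\<^sub>0" using that \<epsilon> by auto
    from max[OF this] have "(\<integral>z. m x z \<partial>P) < (\<integral>z. m \<xi>\<^sub>0 z \<partial>P)"
      by (simp add: population_criterion_def)
    then obtain r U where "0 < r" "integrable P U" "(\<integral>z. U z \<partial>P) < (\<integral>z. m \<xi>\<^sub>0 z \<partial>P)"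
      "\<And>z y. z \<in> space P \<Longrightarrow> y \<in> ball x r \<Longrightarrow> m y z \<le> U z"
      using local_majorant[of \<Xi> m P x] \<open>open \<Xi>\<close> meas cont dom x(1) by metis
    then show ?thesis by (intro exI[of _ r] exI[of _ U]) simp
  qed
  then obtain r U where r: "\<And>x. x \<in> ?S \<Longrightarrow> 0 < r x"
    and int_U: "\<And>x. x \<in> ?S \<Longrightarrow> integrable P (U x)"
    and U_less: "\<And>x. x \<in> ?S \<Longrightarrow> (\<integral>z. U x z \<partial>P) < (\<integral>z. m \<xi>\<^sub>0 z \<partial>P)"
    and U: "\<And>x z y. x \<in> ?S \<Longrightarrow> z \<in> space P \<Longrightarrow> y \<in> ball x (r x) \<Longrightarrow> m y z \<le> U x z"
    by metis
  define V where "V x z = U x z - m \<xi>\<^sub>0 z" for x z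
  \<comment> \<open>half the gap, so that the expectation of \<open>V x\<close> lies strictly below \<open>- d x\<close>\<close>
  define d where "d x = - (\<integral>z. V x z \<partial>P) / 2" for x
  have int_V: "integrable P (V x)" if "x \<in> ?S" for x
    using int_U[OF that] int by (simp add: V_def[abs_def])
  have d_pos: "0 < d x" if "x \<in> ?S" for x
    using U_less[OF that] int_U[OF that] int by (simp add: d_def V_def)
  obtain F where F: "F \<subseteq> ?S" "finite F" "?S \<subseteq> (\<Union>x\<in>F. ball x (r x))"
    by (rule compactE_image[of ?S ?S "\<lambda>x. ball x (r x)"]) (use r in auto)
  \<comment> \<open>the element 1 makes the minimum meaningful without an argument that \<open>F\<close> is nonempty\<close>
  define \<delta> where "\<delta> = Min (insert 1 (d ` F))"
  have \<delta>: "0 < \<delta>" "\<And>x. x \<in> F \<Longrightarrow> \<delta> \<le> d x"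
    using F(1,2) d_pos by (auto simp: \<delta>_def)
  define E where "E x n = {\<omega> \<in> space W. - d x \<le> (\<Sum>i=1..n. V x (Z i \<omega>)) / real n}" for x n
  have E_sets: "E x n \<in> sets W" if "x \<in> F" for x n
  proof -
    have [measurable]: "V x \<in> borel_measurable P" using int_V that F(1) by blast
    show ?thesis unfolding E_def by measurable
  qed
  show thesis
  proof (rule that[of \<delta> "\<lambda>n. \<Union>x\<in>F. E x n"])
    show "0 < \<delta>" by fact
    show "(\<Union>x\<in>F. E x n) \<in> sets W" for n using F(2) E_sets by auto
    have "(\<lambda>n. measure W (E x n)) \<longlonglongrightarrow> 0" if "x \<in> F" for x
      unfolding E_def using that F(1) d_pos int_V
      by (intro weak_law_upper[OF W iid]) (auto simp: d_def)
    then have "(\<lambda>n. \<Sum>x\<in>F. measure W (E x n)) \<longlonglongrightarrow> 0"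
      by (intro tendsto_null_sum) auto
    then show "(\<lambda>n. measure W (\<Union>x\<in>F. E x n)) \<longlonglongrightarrow> 0"
    proof (rule tendsto_sandwich[OF _ _ tendsto_const, rotated 2])
      show "\<forall>\<^sub>F n in sequentially. measure W (\<Union>x\<in>F. E x n) \<le> (\<Sum>x\<in>F. measure W (E x n))"
        using F(2) E_sets by (intro always_eventually allI W.finite_measure_subadditive_finite) auto
    qed auto
  next
    fix n \<omega> \<xi>
    assume n: "1 \<le> n" and \<omega>: "\<omega> \<in> space W" "\<omega> \<notin> (\<Union>x\<in>F. E x n)"
      and \<xi>: "\<xi> \<in> \<Xi>" "\<epsilon> \<le> dist \<xi> \<xi>\<^sub>0"
    let ?M = "empirical_criterion m n (\<lambda>i. Z i \<omega>)"
    have Z_space: "Z i \<omega> \<in> space P" if "i \<in> {1..n}" for i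
      using measurable_space[OF Z \<omega>(1)] that by auto
    show "?M \<xi> \<le> ?M \<xi>\<^sub>0 - \<delta>"
    proof (rule concave_on_le_outside_ball[where S = \<Xi>])
      show "concave_on \<Xi> ?M"
        using concave_on_imp_convex[OF conc] Z_space conc n
        by (intro concave_on_empirical_criterion) (auto intro!: concave_on_imp_convex[OF conc, of "Z 1 \<omega>"])
      fix y assume y: "y \<in> ?S"
      then obtain x where x: "x \<in> F" "y \<in> ball x (r x)" using F(3) by blast
      have "?M y - ?M \<xi>\<^sub>0 = (\<Sum>i=1..n. m y (Z i \<omega>) - m \<xi>\<^sub>0 (Z i \<omega>)) / real n"
        by (simp add: empirical_criterion_def sum_subtractf diff_divide_distrib)
      also have "\<dots> \<le> (\<Sum>i=1..n. V x (Z i \<omega>)) / real n"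
        using x F(1) U[OF _ Z_space x(2)]
        by (intro divide_right_mono sum_mono) (auto simp: V_def)
      also have "\<dots> < - d x"
        using \<omega> x(1) by (auto simp: E_def)
      also have "\<dots> \<le> - \<delta>" using \<delta>(2)[OF x(1)] by simp
      finally show "?M y \<le> ?M \<xi>\<^sub>0 - \<delta>" by simp
    qed (use \<xi> \<xi>\<^sub>0 \<epsilon> \<delta> in auto)
  qed
qed

section \<open>Consistency and existence\<close>

lemma SUP_dense_subset:
  fixes f :: "'a::metric_space \<Rightarrow> real"
  assumes "continuous_on S f" "R \<subseteq> S" "D \<subseteq> R" "R \<subseteq> closure D"
  shows "(SUP x\<in>R. ereal (f x)) = (SUP x\<in>D. ereal (f x))"
proof (rule antisym)
  show "(SUP x\<in>D. ereal (f x)) \<le> (SUP x\<in>R. ereal (f x))"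
    using \<open>D \<subseteq> R\<close> by (rule SUP_subset_mono) simp
  show "(SUP x\<in>R. ereal (f x)) \<le> (SUP x\<in>D. ereal (f x))"
  proof (rule SUP_least)
    fix x assume x: "x \<in> R"
    show "ereal (f x) \<le> (SUP x\<in>D. ereal (f x))"
    proof (rule ereal_le_real)
      fix c assume c: "(SUP x\<in>D. ereal (f x)) \<le> ereal c"
      then have "f y \<le> c" if "y \<in> D" for y
        using SUP_upper[OF that, of "\<lambda>x. ereal (f x)"] order_trans by fastforce
      then show "ereal (f x) \<le> ereal c"
        using continuous_on_le_closure[OF assms(1), of D x c] assms(2-4) x by auto
    qed
  qed
qed

lemma near_maximiser_exists:
  fixes f :: "nat \<Rightarrow> real"
  assumes "(SUP k. ereal (f k)) < \<infinity>" and e: "0 < e"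
  shows "\<exists>k. (SUP k. ereal (f k)) \<le> ereal (f k + e)"
proof -
  have "ereal (f 0) \<le> (SUP k. ereal (f k))" by (rule SUP_upper) simp
  with assms(1) obtain s where s: "(SUP k. ereal (f k)) = ereal s"
    by (cases "SUP k. ereal (f k)") auto
  have "ereal (s - e) < (SUP k. ereal (f k))" using e by (simp add: s)
  then obtain k where "s - e < f k" by (auto simp: less_SUP_iff)
  then have "(SUP k. ereal (f k)) \<le> ereal (f k + e)" by (simp add: s)
  then show ?thesis ..
qed

lemma sample_measurable:
  assumes "prob_space W" "iid_copies W P Z"
  shows "(\<lambda>\<omega>. \<lambda>i\<in>{1..n}. Z i \<omega>) \<in> measurable W (Pi\<^sub>M {1..n} (\<lambda>_. P))"
  using iid_copies_measurable[OF assms] by (intro measurable_restrict) auto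

text \<open>An estimate outside the ball forces \<open>A n \<ge> \<delta>\<close> on the good event, and
  \<open>A n\<close> tends to zero in probability.\<close>

lemma strong_M_estimator_consistent:
  fixes m :: "'a::euclidean_space \<Rightarrow> 'z \<Rightarrow> real"
  assumes W: "prob_space W" and iid: "iid_copies W P Z"
    and meas: "\<And>\<xi>. \<xi> \<in> \<Xi> \<Longrightarrow> m \<xi> \<in> borel_measurable P"
    and "open \<Xi>" and conc: "\<And>z. z \<in> space P \<Longrightarrow> concave_on \<Xi> (\<lambda>\<xi>. m \<xi> z)"
    and int: "integrable P (m \<xi>\<^sub>0)"
    and max: "\<And>\<xi>. \<xi> \<in> \<Xi> \<Longrightarrow> \<xi> \<noteq> \<xi>\<^sub>0 \<Longrightarrow> population_criterion P m \<xi> < population_criterion P m \<xi>\<^sub>0"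
    and dom: "\<And>K. compact K \<Longrightarrow> K \<subseteq> \<Xi> \<Longrightarrow> (\<integral>\<^sup>+z. (SUP \<xi>\<in>K. ennreal \<bar>m \<xi> z\<bar>) \<partial>P) < \<infinity>"
    and R: "R \<subseteq> \<Xi>" "\<xi>\<^sub>0 \<in> R" and est: "strong_M_estimator W P Z m R est"
  shows "converges_in_probability W (estimate Z est) \<xi>\<^sub>0"
  unfolding converges_in_probability_def
proof (intro allI impI)
  fix \<epsilon> :: real assume "0 < \<epsilon>"
  interpret W: prob_space W by fact
  from R \<open>open \<Xi>\<close> obtain \<epsilon>\<^sub>0 where \<epsilon>\<^sub>0: "0 < \<epsilon>\<^sub>0" "cball \<xi>\<^sub>0 \<epsilon>\<^sub>0 \<subseteq> \<Xi>"
    by (meson open_contains_cball subsetD)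
  \<comment> \<open>separation is available for balls inside \<open>\<Xi>\<close> only, which suffices for larger \<open>\<epsilon>\<close> as well\<close>
  have "0 < min \<epsilon> \<epsilon>\<^sub>0" "cball \<xi>\<^sub>0 (min \<epsilon> \<epsilon>\<^sub>0) \<subseteq> \<Xi>" using \<open>0 < \<epsilon>\<close> \<epsilon>\<^sub>0 by auto
  from criterion_separation[OF W iid meas \<open>open \<Xi>\<close> conc int max dom this]
  obtain \<delta> Bad where \<delta>: "0 < \<delta>" and Bad: "\<And>n. Bad n \<in> sets W" "(\<lambda>n. measure W (Bad n)) \<longlonglongrightarrow> 0"
    and sep: "\<And>n \<omega> \<xi>. 1 \<le> n \<Longrightarrow> \<omega> \<in> space W \<Longrightarrow> \<omega> \<notin> Bad n \<Longrightarrow> \<xi> \<in> \<Xi> \<Longrightarrow>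
      min \<epsilon> \<epsilon>\<^sub>0 \<le> dist \<xi> \<xi>\<^sub>0 \<Longrightarrow>
      empirical_criterion m n (\<lambda>i. Z i \<omega>) \<xi> \<le> empirical_criterion m n (\<lambda>i. Z i \<omega>) \<xi>\<^sub>0 - \<delta>"
    by blast
  obtain A :: "nat \<Rightarrow> 'b \<Rightarrow> ereal" where
    A_meas [measurable]: "\<And>n. 1 \<le> n \<Longrightarrow> A n \<in> borel_measurable W"
    and A_small: "small_o_p W A (\<lambda>n. 1 / real n)"
    and A: "\<And>n \<omega>. 1 \<le> n \<Longrightarrow> \<omega> \<in> space W \<Longrightarrow>
      (SUP \<xi>\<in>R. ereal (empirical_criterion m n (\<lambda>i. Z i \<omega>) \<xi>))
      \<le> ereal (empirical_criterion m n (\<lambda>i. Z i \<omega>) (estimate Z est n \<omega>)) + A n \<omega>"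
    using est unfolding strong_M_estimator_def by blast
  let ?A = "\<lambda>n. {\<omega> \<in> space W. ereal (\<delta> / 2 * (1 / real n)) < \<bar>A n \<omega>\<bar>}"
  have A_sets: "?A n \<in> sets W" if "1 \<le> n" for n using that by measurable
  have sub: "{\<omega> \<in> space W. \<epsilon> < dist (estimate Z est n \<omega>) \<xi>\<^sub>0} \<subseteq> Bad n \<union> ?A n" if n: "1 \<le> n" for n
  proof
    fix \<omega> assume "\<omega> \<in> {\<omega> \<in> space W. \<epsilon> < dist (estimate Z est n \<omega>) \<xi>\<^sub>0}"
    then have \<omega>: "\<omega> \<in> space W" and far: "\<epsilon> < dist (estimate Z est n \<omega>) \<xi>\<^sub>0" by auto
    let ?M = "empirical_criterion m n (\<lambda>i. Z i \<omega>)"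
    show "\<omega> \<in> Bad n \<union> ?A n"
    proof (cases "\<omega> \<in> Bad n")
      case False
      have "est n \<in> space (Pi\<^sub>M {1..n} (\<lambda>_. P)) \<rightarrow> R"
        using est n by (simp add: strong_M_estimator_def estimator_def)
      then have "estimate Z est n \<omega> \<in> R"
        using measurable_space[OF sample_measurable[OF W iid] \<omega>] by (auto simp: estimate_def)
      then have 1: "?M (estimate Z est n \<omega>) \<le> ?M \<xi>\<^sub>0 - \<delta>"
        using sep[OF n \<omega> False] far R by auto
      have "ereal (?M \<xi>\<^sub>0) \<le> (SUP \<xi>\<in>R. ereal (?M \<xi>))"
        using R by (intro SUP_upper)
      also note A[OF n \<omega>]
      finally have "ereal \<delta> \<le> A n \<omega>" using 1 by (cases "A n \<omega>") auto
      moreover have "\<delta> / 2 * (1 / real n) < \<delta>"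
        using \<delta> n by (simp add: field_simps)
      ultimately have "ereal (\<delta> / 2 * (1 / real n)) < \<bar>A n \<omega>\<bar>"
        by (cases "A n \<omega>") auto
      then show ?thesis using \<omega> by simp
    qed auto
  qed
  show "(\<lambda>n. measure W {\<omega> \<in> space W. \<epsilon> < dist (estimate Z est n \<omega>) \<xi>\<^sub>0}) \<longlonglongrightarrow> 0"
  proof (rule tendsto_sandwich[OF _ _ tendsto_const])
    show "\<forall>\<^sub>F n in sequentially. measure W {\<omega> \<in> space W. \<epsilon> < dist (estimate Z est n \<omega>) \<xi>\<^sub>0}
        \<le> measure W (Bad n) + measure W (?A n)"
      using eventually_ge_at_top[of 1]
    proof eventually_elim
      case (elim n)
      have "measure W {\<omega> \<in> space W. \<epsilon> < dist (estimate Z est n \<omega>) \<xi>\<^sub>0} \<le> measure W (Bad n \<union> ?A n)"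
        using sub[OF elim] Bad(1) A_sets[OF elim] by (intro W.finite_measure_mono) auto
      also have "\<dots> \<le> measure W (Bad n) + measure W (?A n)"
        using Bad(1) A_sets[OF elim] by (intro measure_Un_le)
      finally show ?case .
    qed
    show "(\<lambda>n. measure W (Bad n) + measure W (?A n)) \<longlonglongrightarrow> 0"
      using tendsto_add[OF Bad(2) small_o_pD[OF A_small, of "\<delta> / 2"]] \<delta> by simp
  qed auto
qed

lemma empirical_criterion_measurable:
  assumes "m \<xi> \<in> borel_measurable P"
  shows "(\<lambda>x. empirical_criterion m n x \<xi>) \<in> borel_measurable (Pi\<^sub>M {1..n} (\<lambda>_. P))"
  unfolding empirical_criterion_def
  by (intro borel_measurable_divide borel_measurable_sum borel_measurable_const
      measurable_compose[OF _ assms] measurable_component_singleton)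

text \<open>The estimator takes the first point in an enumeration \<open>d\<close> of a countable dense subset of \<open>R\<close> at which
  the empirical criterion is within \<open>1 / n\<^sup>2 = o(1 / n)\<close> of its supremum; searching a countable set for the
  first such point makes the choice measurable. Where the supremum is infinite the choice is arbitrary,
  and this happens only on the exceptional event of \<open>criterion_separation\<close>.\<close>

lemma strong_M_estimator_exists:
  fixes m :: "'a::euclidean_space \<Rightarrow> 'z \<Rightarrow> real"
  assumes W: "prob_space W" and iid: "iid_copies W P Z"
    and meas: "\<And>\<xi>. \<xi> \<in> \<Xi> \<Longrightarrow> m \<xi> \<in> borel_measurable P"
    and "open \<Xi>" and conc: "\<And>z. z \<in> space P \<Longrightarrow> concave_on \<Xi> (\<lambda>\<xi>. m \<xi> z)"
    and int: "integrable P (m \<xi>\<^sub>0)"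
    and max: "\<And>\<xi>. \<xi> \<in> \<Xi> \<Longrightarrow> \<xi> \<noteq> \<xi>\<^sub>0 \<Longrightarrow> population_criterion P m \<xi> < population_criterion P m \<xi>\<^sub>0"
    and dom: "\<And>K. compact K \<Longrightarrow> K \<subseteq> \<Xi> \<Longrightarrow> (\<integral>\<^sup>+z. (SUP \<xi>\<in>K. ennreal \<bar>m \<xi> z\<bar>) \<partial>P) < \<infinity>"
    and R: "R \<subseteq> \<Xi>" "\<xi>\<^sub>0 \<in> R"
  shows "\<exists>est. strong_M_estimator W P Z m R est"
proof -
  interpret W: prob_space W by fact
  from R \<open>open \<Xi>\<close> obtain \<epsilon> where \<epsilon>: "0 < \<epsilon>" "cball \<xi>\<^sub>0 \<epsilon> \<subseteq> \<Xi>"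
    by (meson open_contains_cball subsetD)
  from criterion_separation[OF W iid meas \<open>open \<Xi>\<close> conc int max dom \<epsilon>]
  obtain \<delta> Bad where \<delta>: "0 < \<delta>" and Bad: "\<And>n. Bad n \<in> sets W" "(\<lambda>n. measure W (Bad n)) \<longlonglongrightarrow> 0"
    and sep: "\<And>n \<omega> \<xi>. 1 \<le> n \<Longrightarrow> \<omega> \<in> space W \<Longrightarrow> \<omega> \<notin> Bad n \<Longrightarrow> \<xi> \<in> \<Xi> \<Longrightarrow> \<epsilon> \<le> dist \<xi> \<xi>\<^sub>0 \<Longrightarrow>
      empirical_criterion m n (\<lambda>i. Z i \<omega>) \<xi> \<le> empirical_criterion m n (\<lambda>i. Z i \<omega>) \<xi>\<^sub>0 - \<delta>"
    by blast
  obtain D where D: "countable D" "D \<subseteq> R" "R \<subseteq> closure D" using separable[of R] by blast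
  then have "D \<noteq> {}" using R by auto
  define d where "d = from_nat_into D"
  have d: "range d = D" unfolding d_def using \<open>D \<noteq> {}\<close> D(1) by (rule range_from_nat_into)
  then have d_R: "d k \<in> R" for k using D(2) by auto
  have dM [measurable]: "(\<lambda>x. empirical_criterion m n x (d k)) \<in> borel_measurable (Pi\<^sub>M {1..n} (\<lambda>_. P))"
    for n k
    using d_R R by (intro empirical_criterion_measurable meas) auto
  define Msup where "Msup n x = (SUP k. ereal (empirical_criterion m n x (d k)))" for n x
  have Msup_meas: "Msup n \<in> borel_measurable (Pi\<^sub>M {1..n} (\<lambda>_. P))" for n
    unfolding Msup_def[abs_def] by measurable
  \<comment> \<open>when no index qualifies, the least one is an unspecified constant\<close>
  define K where
    "K n x = (LEAST k. Msup n x \<le> ereal (empirical_criterion m n x (d k) + 1 / (real n)\<^sup>2))" for n x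
  have K_meas: "K n \<in> measurable (Pi\<^sub>M {1..n} (\<lambda>_. P)) (count_space UNIV)" for n
    unfolding K_def[abs_def]
  proof (rule measurable_Least)
    fix k
    have "(\<lambda>x. ereal (empirical_criterion m n x (d k) + 1 / (real n)\<^sup>2)) \<in> borel_measurable (Pi\<^sub>M {1..n} (\<lambda>_. P))"
      by (intro borel_measurable_ereal borel_measurable_add dM) simp
    then show "Measurable.pred (Pi\<^sub>M {1..n} (\<lambda>_. P))
        (\<lambda>x. Msup n x \<le> ereal (empirical_criterion m n x (d k) + 1 / (real n)\<^sup>2))"
      using Msup_meas[of n] unfolding Measurable.pred_def by (intro borel_measurable_le)
  qed
  have K: "Msup n x \<le> ereal (empirical_criterion m n x (d (K n x)) + 1 / (real n)\<^sup>2)"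
    if "1 \<le> n" "Msup n x < \<infinity>" for n x
    unfolding K_def
  proof (rule LeastI_ex)
    show "\<exists>k. Msup n x \<le> ereal (empirical_criterion m n x (d k) + 1 / (real n)\<^sup>2)"
      using that unfolding Msup_def by (intro near_maximiser_exists) auto
  qed
  define est where "est n x = d (K n x)" for n x
  define S where "S n \<omega> = (\<lambda>i\<in>{1..n}. Z i \<omega>)" for n \<omega>
  define A where "A n \<omega> = Msup n (S n \<omega>) - ereal (empirical_criterion m n (S n \<omega>) (est n (S n \<omega>)))" for n \<omega>
  have S_meas: "S n \<in> measurable W (Pi\<^sub>M {1..n} (\<lambda>_. P))" for n
    unfolding S_def[abs_def] using sample_measurable[OF W iid] .
  have S_emp: "empirical_criterion m n (S n \<omega>) = empirical_criterion m n (\<lambda>i. Z i \<omega>)" for n \<omega>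
    by (rule empirical_criterion_cong) (simp add: S_def)
  have conc_emp: "continuous_on \<Xi> (empirical_criterion m n (\<lambda>i. Z i \<omega>))"
    if "1 \<le> n" "\<omega> \<in> space W" for n \<omega>
  proof (rule concave_on_continuous[OF \<open>open \<Xi>\<close> concave_on_empirical_criterion])
    have Z_space: "Z i \<omega> \<in> space P" if "1 \<le> i" for i
      using measurable_space[OF iid_copies_measurable[OF W iid that] \<open>\<omega> \<in> space W\<close>] .
    then show "convex \<Xi>" using concave_on_imp_convex[OF conc, of "Z 1 \<omega>"] by simp
    show "concave_on \<Xi> (\<lambda>\<xi>. m \<xi> (Z i \<omega>))" if "i \<in> {1..n}" for i
      using conc Z_space that by simp
  qed
  have Msup_eq: "(SUP \<xi>\<in>R. ereal (empirical_criterion m n (\<lambda>i. Z i \<omega>) \<xi>)) = Msup n (S n \<omega>)"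
    if "1 \<le> n" "\<omega> \<in> space W" for n \<omega>
    using SUP_dense_subset[OF conc_emp[OF that] R(1) D(2,3)]
    by (simp add: Msup_def S_emp image_image flip: d)
  \<comment> \<open>holds also for an infinite supremum, since the empirical criterion is finite\<close>
  have A_eq: "ereal (empirical_criterion m n (S n \<omega>) (est n (S n \<omega>))) + A n \<omega> = Msup n (S n \<omega>)" for n \<omega>
    unfolding A_def by (cases "Msup n (S n \<omega>)") auto
  have A_nonneg: "0 \<le> A n \<omega>" for n \<omega>
  proof -
    have "ereal (empirical_criterion m n (S n \<omega>) (est n (S n \<omega>))) \<le> Msup n (S n \<omega>)"
      unfolding Msup_def est_def by (rule SUP_upper) simp
    then show ?thesis unfolding A_def by (cases "Msup n (S n \<omega>)") auto
  qed
  have A_meas: "A n \<in> borel_measurable W" if n: "1 \<le> n" for n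
  proof -
    have "(\<lambda>x. empirical_criterion m n x (d (K n x))) \<in> borel_measurable (Pi\<^sub>M {1..n} (\<lambda>_. P))"
      by (rule measurable_compose_countable[OF dM K_meas])
    then have "(\<lambda>x. Msup n x - ereal (empirical_criterion m n x (est n x))) \<in> borel_measurable (Pi\<^sub>M {1..n} (\<lambda>_. P))"
      using Msup_meas by (simp add: est_def)
    from measurable_compose[OF S_meas this] show ?thesis by (simp add: A_def[abs_def])
  qed
  have A_le: "A n \<omega> \<le> ereal (1 / (real n)\<^sup>2)"
    if n: "1 \<le> n" and \<omega>: "\<omega> \<in> space W" "\<omega> \<notin> Bad n" for n \<omega>
  proof -
    let ?M = "empirical_criterion m n (\<lambda>i. Z i \<omega>)"
    have "compact (?M ` cball \<xi>\<^sub>0 \<epsilon>)"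
      using continuous_on_subset[OF conc_emp[OF n \<omega>(1)] \<epsilon>(2)] by (intro compact_continuous_image) auto
    then have bdd: "bdd_above (?M ` cball \<xi>\<^sub>0 \<epsilon>)"
      by (intro bounded_imp_bdd_above compact_imp_bounded)
    define b where "b = (SUP \<xi>\<in>cball \<xi>\<^sub>0 \<epsilon>. ?M \<xi>)"
    have b: "?M \<xi> \<le> b" if "\<xi> \<in> cball \<xi>\<^sub>0 \<epsilon>" for \<xi>
      unfolding b_def using that bdd by (rule cSUP_upper)
    have "?M (d k) \<le> b" for k
    proof (cases "d k \<in> cball \<xi>\<^sub>0 \<epsilon>")
      case False
      then have "?M (d k) \<le> ?M \<xi>\<^sub>0 - \<delta>"
        using d_R R by (intro sep[OF n \<omega>]) (auto simp: dist_commute)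
      also have "\<dots> \<le> b" using b[of \<xi>\<^sub>0] \<epsilon> \<delta> by simp
      finally show ?thesis .
    qed (rule b)
    then have "Msup n (S n \<omega>) \<le> ereal b"
      unfolding Msup_def S_emp by (intro SUP_least) simp
    then have "Msup n (S n \<omega>) < \<infinity>" by (auto intro: le_less_trans)
    from K[OF n this] show ?thesis
      unfolding A_def est_def by (cases "Msup n (S n \<omega>)") auto
  qed
  have "small_o_p W A (\<lambda>n. 1 / real n)"
    unfolding small_o_p_def
  proof (intro allI impI)
    fix \<rho> :: real assume \<rho>: "0 < \<rho>"
    obtain N :: nat where N: "1 / \<rho> < real N" using reals_Archimedean2 by blast
    show "(\<lambda>n. measure W {\<omega> \<in> space W. ereal (\<rho> * (1 / real n)) < \<bar>A n \<omega>\<bar>}) \<longlonglongrightarrow> 0"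
    proof (rule tendsto_sandwich[OF _ _ tendsto_const Bad(2)])
      show "\<forall>\<^sub>F n in sequentially.
          measure W {\<omega> \<in> space W. ereal (\<rho> * (1 / real n)) < \<bar>A n \<omega>\<bar>} \<le> measure W (Bad n)"
        using eventually_ge_at_top[of "max N 1"]
      proof eventually_elim
        case (elim n)
        then have n: "1 \<le> n" "1 / \<rho> < real n" using N by auto
        then have "1 / (real n)\<^sup>2 \<le> \<rho> * (1 / real n)"
          using \<rho> by (simp add: field_simps power2_eq_square)
        then have "A n \<omega> \<le> ereal (\<rho> * (1 / real n))" if "\<omega> \<in> space W" "\<omega> \<notin> Bad n" for \<omega>
          using A_le[OF n(1) that] by (meson ereal_less_eq(3) order_trans)
        then have "{\<omega> \<in> space W. ereal (\<rho> * (1 / real n)) < \<bar>A n \<omega>\<bar>} \<subseteq> Bad n"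
          using A_nonneg by (auto simp: not_less[symmetric])
        then show ?case using Bad(1) by (rule W.finite_measure_mono)
      qed
    qed auto
  qed
  moreover have "estimator P R est"
    unfolding estimator_def est_def[abs_def]
  proof (intro allI impI conjI)
    show "(\<lambda>x. d (K n x)) \<in> borel_measurable (Pi\<^sub>M {1..n} (\<lambda>_. P))" for n
      by (rule measurable_compose[OF K_meas]) simp
  qed (use d_R in auto)
  moreover have "(SUP \<xi>\<in>R. ereal (empirical_criterion m n (\<lambda>i. Z i \<omega>) \<xi>))
      \<le> ereal (empirical_criterion m n (\<lambda>i. Z i \<omega>) (estimate Z est n \<omega>)) + A n \<omega>"
    if "1 \<le> n" "\<omega> \<in> space W" for n \<omega>
    using A_eq[of n \<omega>] by (simp add: Msup_eq[OF that] S_emp) (simp add: estimate_def S_def)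
  ultimately show ?thesis
    using A_meas unfolding strong_M_estimator_def by blast
qed

theorem proposition2p4:
  fixes W :: "'w measure" and P :: "'z measure" and Z :: "nat \<Rightarrow> 'w \<Rightarrow> 'z"
    and m :: "'a::euclidean_space \<Rightarrow> 'z \<Rightarrow> real" and \<Xi> :: "'a set" and \<xi>\<^sub>0 :: 'a
    and \<Theta> :: "(real ^ 'q) set" and g :: "real ^ 'q \<Rightarrow> 'a"
  assumes "prob_space W" and "prob_space P"
    and iid: "iid_copies W P Z"
    and meas: "\<And>\<xi>. \<xi> \<in> \<Xi> \<Longrightarrow> m \<xi> \<in> borel_measurable P"
    and a: "convex \<Xi>" "open \<Xi>"
      "\<And>z. z \<in> space P \<Longrightarrow> strictly_concave_on \<Xi> (\<lambda>\<xi>. m \<xi> z)"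
    and b: "\<And>\<xi>. \<xi> \<in> \<Xi> \<Longrightarrow> integrable P (m \<xi>)" "\<xi>\<^sub>0 \<in> \<Xi>"
      "\<And>\<xi>. \<xi> \<in> \<Xi> \<Longrightarrow> \<xi> \<noteq> \<xi>\<^sub>0 \<Longrightarrow> population_criterion P m \<xi>\<^sub>0 > population_criterion P m \<xi>"
    and c: "\<And>K. compact K \<Longrightarrow> K \<subseteq> \<Xi> \<Longrightarrow> (\<integral>\<^sup>+z. (SUP \<xi>\<in>K. ennreal \<bar>m \<xi> z\<bar>) \<partial>P) < \<infinity>"
    and d: "open \<Theta>" "g \<in> \<Theta> \<rightarrow> \<Xi>" "\<xi>\<^sub>0 \<in> g ` \<Theta>"
  shows "(\<exists>est. strong_M_estimator W P Z m (g ` \<Theta>) est) \<and>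
    (\<forall>est. strong_M_estimator W P Z m (g ` \<Theta>) est \<longrightarrow>
       converges_in_probability W (estimate Z est) \<xi>\<^sub>0)"
proof (intro conjI allI impI)
  note conc = strictly_concave_on_imp_concave_on[OF a(3)]
  have R: "g ` \<Theta> \<subseteq> \<Xi>" using d(2) by auto
  show "\<exists>est. strong_M_estimator W P Z m (g ` \<Theta>) est"
    by (rule strong_M_estimator_exists[OF assms(1) iid meas a(2) conc b(1)[OF b(2)] b(3) c R d(3)])
  show "converges_in_probability W (estimate Z est) \<xi>\<^sub>0"
    if "strong_M_estimator W P Z m (g ` \<Theta>) est" for est
    by (rule strong_M_estimator_consistent[OF assms(1) iid meas a(2) conc b(1)[OF b(2)] b(3) c R d(3) that])
qed

end
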